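(* Let $M=\mathbb{S}^1$ be the unit circle equipped with the standard metric and consider the magnetic potential $t\eta$, for $t>0$, where $\eta=d\theta$ is the unit parallel $1$-form on $\mathbb{S}^1$. The spectrum of the magnetic Hodge Laplacian $\Delta^{t\eta}$ on $1$-forms is given by $(k\pm t)^2$, where $k\in\mathbb{Z}$. In particular, for $k\in\mathbb{Z}$, the first magnetic Betti number satisfies $b_1^{k\eta}(M)=1$.
   Context: For a real $1$-form $\eta$ (identified with a vector field via the metric), $d^\eta:=d+i\eta\wedge$, $\delta^\eta:=\delta-i\eta\lrcorner$ with $\delta$ the formal $L^2$-adjoint of $d$, and $\Delta^\eta:=d^\eta\delta^\eta+\delta^\eta d^\eta$, acting on smooth complex differential forms. The first magnetic Betti number is $b_1^{\eta}(M):=\dim_{\mathbb{C}}\ker(\Delta^{\eta})$, with $\Delta^\eta$ acting on complex $1$-forms. *)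

theory Defs
  imports "HOL-Analysis.Analysis" "HOL-Library.Function_Algebras"
begin

section \<open>Complex differential forms on the unit circle\<close>

abbreviation S1 :: "complex set"
  where "S1 \<equiv> sphere 0 1"

definition tangent_space :: "complex \<Rightarrow> complex set"
  where "tangent_space p = {v. v \<bullet> p = 0}"

text \<open>The unit vector field \<open>\<partial>/\<partial>\<theta>\<close>, the velocity of \<open>\<theta> \<mapsto> cis \<theta>\<close>.\<close>

definition unit_tangent :: "complex \<Rightarrow> complex"
  where "unit_tangent p = \<i> * p"

definition smooth :: "(real \<Rightarrow> complex) \<Rightarrow> bool"
  where "smooth h \<longleftrightarrow>
    (\<forall>n x. ((\<lambda>g s. vector_derivative g (at s)) ^^ n) h differentiable (at x))"

text \<open>
  A form is a pair consisting of its components in degree \<open>0\<close> and \<open>1\<close>; on a one-dimensional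
  manifold all forms of higher degree vanish. A covector at \<open>p\<close>, a real-linear functional on
  the tangent space at \<open>p\<close>, is represented by its unique real-linear extension to the ambient
  plane that vanishes on the normal line \<open>\<real>p\<close>. Off the circle, all forms are normalised to \<open>0\<close>,
  so that equality of forms is equality in HOL.
\<close>

type_synonym form = "(complex \<Rightarrow> complex) \<times> (complex \<Rightarrow> complex \<Rightarrow> complex)"
type_synonym real_one_form = "complex \<Rightarrow> complex \<Rightarrow> real"

text \<open>Smoothness is tested in the local coordinate \<open>\<theta>\<close> and the frame \<open>\<partial>/\<partial>\<theta>\<close>.\<close>

definition smooth_function :: "(complex \<Rightarrow> complex) \<Rightarrow> bool"
  where "smooth_function f \<longleftrightarrow> smooth (\<lambda>\<theta>. f (cis \<theta>)) \<and> (\<forall>p. p \<notin> S1 \<longrightarrow> f p = 0)"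

definition smooth_one_form :: "(complex \<Rightarrow> complex \<Rightarrow> complex) \<Rightarrow> bool"
  where "smooth_one_form \<omega> \<longleftrightarrow>
    (\<forall>p\<in>S1. linear (\<omega> p) \<and> \<omega> p p = 0) \<and>
    smooth (\<lambda>\<theta>. \<omega> (cis \<theta>) (unit_tangent (cis \<theta>))) \<and>
    (\<forall>p v. p \<notin> S1 \<longrightarrow> \<omega> p v = 0)"

definition forms :: "form set"
  where "forms = {(f, \<omega>). smooth_function f \<and> smooth_one_form \<omega>}"

definition one_forms :: "form set"
  where "one_forms = {(f, \<omega>). f = 0 \<and> smooth_one_form \<omega>}"

definition form_scale :: "complex \<Rightarrow> form \<Rightarrow> form"
  where "form_scale c \<alpha> = ((\<lambda>p. c * fst \<alpha> p), (\<lambda>p v. c * snd \<alpha> p v))"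

interpretation form: vector_space form_scale
  by unfold_locales (auto simp: form_scale_def fun_eq_iff prod_eq_iff algebra_simps)

section \<open>The $L^2$ product, exterior derivative and codifferential\<close>

text \<open>The first summand and the second one are the pointwise Hermitian products on functions
  and on covectors; the volume form is \<open>d\<theta>\<close>.\<close>

definition L2_inner :: "form \<Rightarrow> form \<Rightarrow> complex"
  where "L2_inner \<alpha> \<beta> = integral {0..2 * pi} (\<lambda>\<theta>. let p = cis \<theta>; e = unit_tangent p in
    fst \<alpha> p * cnj (fst \<beta> p) + snd \<alpha> p e * cnj (snd \<beta> p e))"

definition L2_norm :: "form \<Rightarrow> real"
  where "L2_norm \<alpha> = sqrt (Re (L2_inner \<alpha> \<alpha>))"

text \<open>For tangent \<open>v\<close>, the curve \<open>s \<mapsto> p * cis (s * (v \<bullet> unit_tangent p))\<close> is the geodesic through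
  \<open>p\<close> with initial velocity \<open>v\<close>. The differential of a 1-form is a 2-form, hence zero.\<close>

definition ext_d :: "form \<Rightarrow> form"
  where "ext_d \<alpha> = (0, \<lambda>p v. if p \<in> S1
    then vector_derivative (\<lambda>s. fst \<alpha> (p * cis (s * (v \<bullet> unit_tangent p)))) (at 0) else 0)"

definition codiff :: "form \<Rightarrow> form"
  where "codiff \<alpha> = (THE \<beta>. \<beta> \<in> forms \<and> (\<forall>\<gamma>\<in>forms. L2_inner (ext_d \<gamma>) \<alpha> = L2_inner \<gamma> \<beta>))"

section \<open>The magnetic Hodge Laplacian\<close>

definition sharp :: "real_one_form \<Rightarrow> complex \<Rightarrow> complex"
  where "sharp \<eta> p = (THE u. u \<in> tangent_space p \<and> (\<forall>v\<in>tangent_space p. \<eta> p v = u \<bullet> v))"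

definition wedge :: "real_one_form \<Rightarrow> form \<Rightarrow> form"
  where "wedge \<eta> \<alpha> = (0, \<lambda>p v. complex_of_real (\<eta> p v) * fst \<alpha> p)"

definition contract :: "real_one_form \<Rightarrow> form \<Rightarrow> form"
  where "contract \<eta> \<alpha> = ((\<lambda>p. snd \<alpha> p (sharp \<eta> p)), 0)"

definition magnetic_d :: "real_one_form \<Rightarrow> form \<Rightarrow> form"
  where "magnetic_d \<eta> \<alpha> = ext_d \<alpha> + form_scale \<i> (wedge \<eta> \<alpha>)"

definition magnetic_codiff :: "real_one_form \<Rightarrow> form \<Rightarrow> form"
  where "magnetic_codiff \<eta> \<alpha> = codiff \<alpha> - form_scale \<i> (contract \<eta> \<alpha>)"

definition magnetic_laplacian :: "real_one_form \<Rightarrow> form \<Rightarrow> form"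
  where "magnetic_laplacian \<eta> \<alpha> =
    magnetic_d \<eta> (magnetic_codiff \<eta> \<alpha>) + magnetic_codiff \<eta> (magnetic_d \<eta> \<alpha>)"

text \<open>
  The $L^2$ spectrum of an operator \<open>T\<close> with the dense domain \<open>V\<close> of smooth forms: \<open>z\<close> is a
  regular value iff \<open>T - z\<close> is injective with bounded inverse and has dense range, equivalently
  iff the closure of \<open>T - z\<close> in the $L^2$ completion of \<open>V\<close> has a bounded, everywhere defined
  inverse.
\<close>

definition regular_value :: "form set \<Rightarrow> (form \<Rightarrow> form) \<Rightarrow> complex \<Rightarrow> bool"
  where "regular_value V T z \<longleftrightarrow>
    (\<exists>c>0. \<forall>\<alpha>\<in>V. c * L2_norm \<alpha> \<le> L2_norm (T \<alpha> - form_scale z \<alpha>)) \<and>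
    (\<forall>\<beta>\<in>V. \<forall>\<epsilon>>0. \<exists>\<alpha>\<in>V. L2_norm (T \<alpha> - form_scale z \<alpha> - \<beta>) < \<epsilon>)"

definition spectrum :: "form set \<Rightarrow> (form \<Rightarrow> form) \<Rightarrow> complex set"
  where "spectrum V T = {z. \<not> regular_value V T z}"

definition magnetic_betti_1 :: "real_one_form \<Rightarrow> nat"
  where "magnetic_betti_1 \<eta> = form.dim {\<alpha> \<in> one_forms. magnetic_laplacian \<eta> \<alpha> = 0}"

text \<open>The 1-form dual to \<open>\<partial>/\<partial>\<theta>\<close>.\<close>

definition dtheta :: real_one_form
  where "dtheta p v = (if p \<in> S1 then v \<bullet> unit_tangent p else 0)"

definition scaled :: "real \<Rightarrow> real_one_form \<Rightarrow> real_one_form"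
  where "scaled t \<eta> = (\<lambda>p v. t * \<eta> p v)"

end

theory Submission
  imports Defs
begin

text \<open>
  In the coordinate \<open>\<theta>\<close> a 1-form is a smooth \<open>2\<pi>\<close>-periodic function \<open>g\<close>, and the Laplacian becomes
  \<open>- (d/d\<theta> + i t)\<^sup>2\<close>, with eigenfunctions \<open>exp (i k \<theta>)\<close>. For \<open>z = w\<^sup>2\<close> the operator minus \<open>z\<close> factors as
  \<open>- (d/d\<theta> + i (t - w)) (d/d\<theta> + i (t + w))\<close>. An integrating factor shows that the periodic equation
  \<open>g' + a g = h\<close> is solvable with an $L^2$ bound whenever \<open>exp (2\<pi> a) \<noteq> 1\<close>; hence \<open>z\<close> is regular
  unless \<open>t - w\<close> or \<open>t + w\<close> is an integer. This makes completeness of the Fourier basis unnecessary.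
  For \<open>t = k\<close> an integer, \<open>exp (i k \<theta>) g\<close> is periodic, so that on the kernel it is affine and periodic,
  hence constant.
\<close>

section \<open>Smooth periodic functions\<close>

definition D :: "(real \<Rightarrow> complex) \<Rightarrow> real \<Rightarrow> complex"
  where "D g = (\<lambda>s. vector_derivative g (at s))"

lemma smooth_iff_D: "smooth g \<longleftrightarrow> (\<forall>n x. (D ^^ n) g differentiable (at x))"
  unfolding smooth_def D_def ..

lemma smooth_has_vector_derivative:
  assumes "smooth g"
  shows "(g has_vector_derivative D g x) (at x)"
proof -
  have "(D ^^ 0) g differentiable (at x)"
    using assms unfolding smooth_iff_D by blast
  then show ?thesis
    by (simp add: D_def vector_derivative_works)
qed

lemma smooth_D:
  assumes "smooth g"
  shows "smooth (D g)"
  unfolding smooth_iff_D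
proof (intro allI)
  fix n x
  have "(D ^^ Suc n) g differentiable (at x)"
    using assms unfolding smooth_iff_D by blast
  then show "(D ^^ n) (D g) differentiable (at x)"
    by (simp add: funpow_swap1)
qed

lemma smooth_funpow_D: "smooth g \<Longrightarrow> smooth ((D ^^ n) g)"
  by (induction n) (auto intro: smooth_D)

lemma D_eqI:
  assumes "\<And>x. (g has_vector_derivative g' x) (at x)"
  shows "D g = g'"
  using vector_derivative_at[OF assms] by (auto simp: D_def)

text \<open>Exhibiting all derivatives at once as a sequence \<open>F\<close> identifies
  \<open>F n\<close> with the iterate \<open>D ^^ n\<close> by induction, so smoothness needs no
  separate differentiability argument for each iterate.\<close>

lemma smoothI:
  assumes "\<And>n x. (F n has_vector_derivative F (Suc n) x) (at x)"
  shows "smooth (F 0)"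
proof -
  have "(D ^^ n) (F 0) = F n" for n
    by (induction n) (auto intro: D_eqI assms)
  then show ?thesis
    unfolding smooth_iff_D using assms
    by (auto intro: differentiableI_vector)
qed

text \<open>These are the smooth functions on the line that descend to the circle. They serve as
  coordinate functions for forms in both degrees.\<close>

definition circle_smooth :: "(real \<Rightarrow> complex) \<Rightarrow> bool"
  where "circle_smooth g \<longleftrightarrow> smooth g \<and> (\<forall>\<theta>. g (\<theta> + 2 * pi) = g \<theta>)"

lemma circle_smooth_periodic: "circle_smooth g \<Longrightarrow> g (\<theta> + 2 * pi) = g \<theta>"
  by (simp add: circle_smooth_def)

lemma circle_smooth_DERIV: "circle_smooth g \<Longrightarrow> (g has_vector_derivative D g x) (at x)"
  by (simp add: circle_smooth_def smooth_has_vector_derivative)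

lemma circle_smooth_continuous: "circle_smooth g \<Longrightarrow> continuous_on A g"
  by (meson circle_smooth_DERIV continuous_at_imp_continuous_on has_vector_derivative_continuous)

lemma circle_smooth_D:
  assumes "circle_smooth g"
  shows "circle_smooth (D g)"
proof -
  have "D g (x + 2 * pi) = D g x" for x
  proof -
    \<comment> \<open>The shift of \<open>g\<close> by a period is \<open>g\<close> itself, so
      uniqueness of derivatives compares \<open>D g\<close> at \<open>x + 2 * pi\<close> and at
      \<open>x\<close>.\<close>
    have "((g \<circ> (\<lambda>s. s + 2 * pi)) has_vector_derivative 1 *\<^sub>R D g (x + 2 * pi)) (at x)"
      by (rule vector_diff_chain_at)
        (auto intro!: derivative_eq_intros circle_smooth_DERIV[OF assms])
    moreover have "g \<circ> (\<lambda>s. s + 2 * pi) = g"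
      using circle_smooth_periodic[OF assms] by auto
    ultimately show ?thesis
      using circle_smooth_DERIV[OF assms, of x] vector_derivative_unique_at by fastforce
  qed
  then show ?thesis
    using assms by (auto simp: circle_smooth_def smooth_D)
qed

text \<open>The same combination of the \<open>n\<close>-th derivatives of \<open>f\<close> and
  \<open>g\<close> is the witness for \<open>smoothI\<close>. Sums, differences and multiples are
  later read off as special cases.\<close>

lemma circle_smooth_lin:
  assumes f: "circle_smooth f" and g: "circle_smooth g"
  shows "circle_smooth (\<lambda>x. a * f x + b * g x)"
    and "D (\<lambda>x. a * f x + b * g x) = (\<lambda>x. a * D f x + b * D g x)"
proof -
  have der: "((\<lambda>x. a * (D ^^ n) f x + b * (D ^^ n) g x) has_vector_derivative
      (a * (D ^^ Suc n) f x + b * (D ^^ Suc n) g x)) (at x)" for n x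
    using f g smooth_has_vector_derivative[OF smooth_funpow_D, of f n x]
      smooth_has_vector_derivative[OF smooth_funpow_D, of g n x]
    unfolding circle_smooth_def by (auto intro!: derivative_eq_intros)
  have "smooth (\<lambda>x. a * (D ^^ 0) f x + b * (D ^^ 0) g x)"
    by (rule smoothI[where F = "\<lambda>n x. a * (D ^^ n) f x + b * (D ^^ n) g x"]) (rule der)
  then show "circle_smooth (\<lambda>x. a * f x + b * g x)"
    using f g by (auto simp: circle_smooth_def)
  show "D (\<lambda>x. a * f x + b * g x) = (\<lambda>x. a * D f x + b * D g x)"
    using der[of 0] by (auto intro: D_eqI)
qed

lemma exp_of_real_has_vector_derivative:
  "((\<lambda>x. exp (a * complex_of_real x)) has_vector_derivative a * exp (a * of_real x)) (at x)"
proof -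
  have "((\<lambda>z. exp (a * z)) has_field_derivative a * exp (a * of_real x)) (at (of_real x))"
    by (auto intro!: derivative_eq_intros)
  then show ?thesis
    by (rule has_vector_derivative_real_field)
qed

text \<open>The hypothesis says exactly that the exponential has period \<open>2 * pi\<close>; its
  \<open>n\<close>-th derivative is \<open>a ^ n\<close> times itself.\<close>

lemma circle_smooth_exp:
  assumes "exp (a * of_real (2 * pi)) = 1"
  shows "circle_smooth (\<lambda>x. exp (a * of_real x))"
    and "D (\<lambda>x. exp (a * of_real x)) = (\<lambda>x. a * exp (a * of_real x))"
proof -
  have "smooth (\<lambda>x. a ^ 0 * exp (a * of_real x))"
    by (rule smoothI[where F = "\<lambda>n x. a ^ n * exp (a * of_real x)"])
      (auto intro!: derivative_eq_intros exp_of_real_has_vector_derivative)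
  moreover have "exp (a * of_real (x + 2 * pi)) = exp (a * of_real x)" for x
    using assms by (simp add: distrib_left exp_add)
  ultimately show "circle_smooth (\<lambda>x. exp (a * of_real x))"
    by (simp add: circle_smooth_def)
  show "D (\<lambda>x. exp (a * of_real x)) = (\<lambda>x. a * exp (a * of_real x))"
    by (rule D_eqI) (rule exp_of_real_has_vector_derivative)
qed

lemma periodic_int:
  fixes g :: "real \<Rightarrow> 'a"
  assumes "\<And>x. g (x + 2 * pi) = g x"
  shows "g (x + 2 * pi * of_int k) = g x"
proof -
  have nat: "g (x + 2 * pi * real n) = g x" for n x
  proof (induction n)
    case (Suc n)
    have "g (x + 2 * pi * real (Suc n)) = g ((x + 2 * pi * real n) + 2 * pi)"
      by (simp add: algebra_simps)
    then show ?case using assms Suc by simp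
  qed simp
  show ?thesis
  proof (cases k rule: int_cases2)
    case (nonneg n)
    then show ?thesis using nat by simp
  next
    case (nonpos n)
    then show ?thesis using nat[of "x - 2 * pi * real n" n] by simp
  qed
qed

section \<open>The first-order periodic equation\<close>

text \<open>This is the L2 norm over one period, which will be the norm of the 1-form with
  coefficient \<open>g\<close>.\<close>

definition nrm :: "(real \<Rightarrow> complex) \<Rightarrow> real"
  where "nrm g = sqrt (integral {0..2 * pi} (\<lambda>x. (norm (g x))\<^sup>2))"

text \<open>This is Cauchy-Schwarz against the constant function 1, obtained from the nonnegativity
  of a variance.\<close>

lemma integral_norm_le_nrm:
  assumes "continuous_on {0..2 * pi} h"
  shows "integral {0..2 * pi} (\<lambda>x. norm (h x)) \<le> sqrt (2 * pi) * nrm h"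
proof -
  define J where "J = integral {0..2 * pi} (\<lambda>x. norm (h x))"
  \<comment> \<open>The mean of \<open>norm (h x)\<close> over the period; with it the integrated
    square collapses to \<open>(nrm h)\<^sup>2 - J\<^sup>2 / (2 * pi)\<close>.\<close>
  define m where "m = J / (2 * pi)"
  have int: "(\<lambda>x. norm (h x)) integrable_on {0..2 * pi}"
    "(\<lambda>x. (norm (h x))\<^sup>2) integrable_on {0..2 * pi}"
    using assms by (auto intro!: integrable_continuous_real continuous_intros)
  have "0 \<le> integral {0..2 * pi} (\<lambda>x. (norm (h x) - m)\<^sup>2)"
    by (rule integral_nonneg) (use assms in \<open>auto intro!: integrable_continuous_real continuous_intros\<close>)
  also have "\<dots> = integral {0..2 * pi} (\<lambda>x. (norm (h x))\<^sup>2 - (2 * m) * norm (h x) + m\<^sup>2)"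
    by (simp add: power2_diff algebra_simps)
  also have "\<dots> = integral {0..2 * pi} (\<lambda>x. (norm (h x))\<^sup>2) - 2 * m * J + 2 * pi * m\<^sup>2"
  proof (rule integral_unique)
    have "((\<lambda>x. m\<^sup>2) has_integral 2 * pi * m\<^sup>2) {0..2 * pi}"
      using has_integral_const_real[of "m\<^sup>2" 0 "2 * pi"] by simp
    then show "((\<lambda>x. (norm (h x))\<^sup>2 - (2 * m) * norm (h x) + m\<^sup>2) has_integral
        integral {0..2 * pi} (\<lambda>x. (norm (h x))\<^sup>2) - 2 * m * J + 2 * pi * m\<^sup>2) {0..2 * pi}"
      using int unfolding J_def
      by (intro has_integral_add has_integral_diff has_integral_mult_right integrable_integral) auto
  qed
  also have "\<dots> = (nrm h)\<^sup>2 - J\<^sup>2 / (2 * pi)"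
  proof -
    have "(nrm h)\<^sup>2 = integral {0..2 * pi} (\<lambda>x. (norm (h x))\<^sup>2)"
      using int by (simp add: nrm_def integral_nonneg)
    then show ?thesis by (simp add: m_def power2_eq_square field_simps)
  qed
  finally have "J\<^sup>2 \<le> (sqrt (2 * pi) * nrm h)\<^sup>2"
    by (simp add: field_simps power_mult_distrib)
  moreover have "0 \<le> sqrt (2 * pi) * nrm h"
    using int by (simp add: nrm_def integral_nonneg)
  ultimately show ?thesis
    unfolding J_def[symmetric] by (rule power2_le_imp_le)
qed

lemma nrm_le_sup:
  assumes "continuous_on {0..2 * pi} g" and "\<And>x. x \<in> {0..2 * pi} \<Longrightarrow> norm (g x) \<le> B" and "0 \<le> B"
  shows "nrm g \<le> sqrt (2 * pi) * B"
proof -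
  have "integral {0..2 * pi} (\<lambda>x. (norm (g x))\<^sup>2) \<le> integral {0..2 * pi} (\<lambda>x. B\<^sup>2)"
    by (rule integral_le)
      (use assms in \<open>auto intro!: integrable_continuous_real continuous_intros power_mono\<close>)
  also have "\<dots> = (sqrt (2 * pi) * B)\<^sup>2"
    by (simp add: power_mult_distrib)
  finally show ?thesis
    unfolding nrm_def using assms(3) by (intro real_le_lsqrt) auto
qed

text \<open>With \<open>h = D g + a g\<close>, the product of \<open>g\<close> and
  \<open>exp (a x)\<close> has derivative \<open>exp (a x) * h x\<close>. Over a full period it
  changes by a nonzero multiple of \<open>g 0\<close>, so the L1 norm of \<open>h\<close> controls
  \<open>g 0\<close>, then the supremum of \<open>g\<close>, and hence \<open>nrm g\<close>.\<close>

lemma first_order_bound: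
  assumes a: "exp (a * of_real (2 * pi)) \<noteq> 1"
  shows "\<exists>c>0. \<forall>g. circle_smooth g \<longrightarrow> c * nrm g \<le> nrm (\<lambda>x. D g x + a * g x)"
proof -
  define M where "M = exp (2 * pi * norm a)"
  define d where "d = norm (exp (a * of_real (2 * pi)) - 1)"
  \<comment> \<open>The summands bound \<open>norm (u 0)\<close> and \<open>norm (u x - u 0)\<close>
    in units of the L1 norm \<open>J\<close> of \<open>h\<close>; the outer \<open>M\<close> bounds
    the factor \<open>exp (- a x)\<close> that recovers \<open>g\<close> from
    \<open>u\<close>.\<close>
  define K where "K = M * (M / d + M)"
  have pos: "0 < M" "0 < d" "0 < K"
    using a by (auto simp: M_def d_def K_def intro!: mult_pos_pos add_pos_pos divide_pos_pos)
  have M: "norm (exp (b * complex_of_real x)) \<le> M"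
    if "x \<in> {0..2 * pi}" "norm b = norm a" for b x
  proof -
    have "norm (exp (b * complex_of_real x)) \<le> exp (norm (b * complex_of_real x))"
      by (rule norm_exp)
    also have "\<dots> \<le> M"
      using that mult_right_mono[of x "2 * pi" "norm a"] by (simp add: M_def norm_mult mult.commute)
    finally show ?thesis .
  qed
  have "1 / (2 * pi * K) * nrm g \<le> nrm (\<lambda>x. D g x + a * g x)" if g: "circle_smooth g" for g
  proof -
    define h where "h = (\<lambda>x. D g x + a * g x)"
    define J where "J = integral {0..2 * pi} (\<lambda>x. norm (h x))"
    define u where "u = (\<lambda>x. exp (a * of_real x) * g x)"
    have h: "continuous_on A h" for A
      using g unfolding h_def
      by (intro continuous_intros circle_smooth_continuous circle_smooth_D)
    have hint: "(\<lambda>x. norm (h x)) integrable_on {0..2 * pi}"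
      by (intro integrable_continuous_real continuous_intros h)
    have J: "0 \<le> J" unfolding J_def using hint by (simp add: integral_nonneg)
    have u': "(u has_vector_derivative exp (a * of_real x) * h x) (at x within A)" for x A
      unfolding u_def h_def
      by (rule has_vector_derivative_at_within)
        (auto intro!: derivative_eq_intros exp_of_real_has_vector_derivative circle_smooth_DERIV[OF g]
          simp: algebra_simps)
    have step: "norm (u x - u 0) \<le> M * J" if x: "x \<in> {0..2 * pi}" for x
    proof -
      have "((\<lambda>x. exp (a * of_real x) * h x) has_integral u x - u 0) {0..x}"
        using x u' by (intro fundamental_theorem_of_calculus) auto
      then have "u x - u 0 = integral {0..x} (\<lambda>x. exp (a * of_real x) * h x)"
        by (simp add: integral_unique)
      also have "norm \<dots> \<le> integral {0..x} (\<lambda>x. M * norm (h x))"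
      proof (rule integral_norm_bound_integral)
        show "norm (exp (a * of_real y) * h y) \<le> M * norm (h y)" if "y \<in> {0..x}" for y
          unfolding norm_mult by (intro mult_right_mono M) (use x that in auto)
      qed (intro integrable_continuous_real continuous_intros h)+
      also have "\<dots> \<le> integral {0..2 * pi} (\<lambda>x. M * norm (h x))"
        by (rule integral_subset_le)
          (use x pos in \<open>auto intro!: integrable_continuous_real continuous_intros h\<close>)
      also have "\<dots> = M * J" by (simp add: J_def)
      finally show ?thesis .
    qed
    \<comment> \<open>Periodicity of \<open>g\<close> enters here: only the integrating factor
      changes between the endpoints.\<close>
    have "u (2 * pi) - u 0 = (exp (a * of_real (2 * pi)) - 1) * g 0"
      using circle_smooth_periodic[OF g, of 0] by (simp add: u_def algebra_simps)
    then have "d * norm (g 0) \<le> M * J"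
      using step[of "2 * pi"] by (simp add: d_def norm_mult)
    then have g0: "norm (g 0) \<le> M / d * J"
      using pos by (simp add: field_simps)
    have "norm (g x) \<le> K * J" if x: "x \<in> {0..2 * pi}" for x
    proof -
      have "g x = exp (- a * of_real x) * u x"
        by (simp add: u_def exp_minus)
      then have "norm (g x) = norm (exp (- a * of_real x)) * norm (u x)"
        by (simp add: norm_mult)
      also have "\<dots> \<le> M * (M / d * J + M * J)"
      proof (rule mult_mono)
        have "norm (u x) \<le> norm (u 0) + norm (u x - u 0)"
          by (rule norm_triangle_sub)
        then show "norm (u x) \<le> M / d * J + M * J"
          using step[OF x] g0 by (simp add: u_def)
        show "norm (exp (- a * of_real x)) \<le> M"
          by (rule M) (use x in auto)
      qed (use pos in auto)
      finally show ?thesis by (simp add: K_def algebra_simps)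
    qed
    then have "nrm g \<le> sqrt (2 * pi) * (K * J)"
      using pos J by (intro nrm_le_sup circle_smooth_continuous[OF g]) auto
    \<comment> \<open>The first \<open>sqrt (2 * pi)\<close> comes from passing from the supremum to
      L2, the second from passing from L1 to L2.\<close>
    also have "\<dots> \<le> sqrt (2 * pi) * (K * (sqrt (2 * pi) * nrm h))"
      using integral_norm_le_nrm[OF h] pos unfolding J_def by (intro mult_left_mono) auto
    also have "\<dots> = 2 * pi * K * nrm h"
      by (simp add: algebra_simps flip: real_sqrt_mult)
    finally show ?thesis
      using pos by (simp add: field_simps h_def)
  qed
  moreover have "0 < 1 / (2 * pi * K)" using pos by simp
  ultimately show ?thesis by blast
qed

text \<open>Variation of constants gives the solutions on the line. The condition on
  \<open>a\<close> allows one of them to be chosen periodic, and the equation itself then yields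
  smoothness.\<close>

lemma first_order_solution:
  assumes a: "exp (a * of_real (2 * pi)) \<noteq> 1" and h: "circle_smooth h"
  shows "\<exists>g. circle_smooth g \<and> (\<forall>x. D g x + a * g x = h x)"
proof -
  \<comment> \<open>Taking infinite endpoints produces an antiderivative on the whole line, with
    two-sided derivatives everywhere.\<close>
  have "\<exists>H. \<forall>x. -\<infinity> < ereal x \<longrightarrow> ereal x < \<infinity> \<longrightarrow>
      (H has_vector_derivative exp (a * of_real x) * h x) (at x)"
    using circle_smooth_continuous[OF h, of UNIV]
    by (intro einterval_antiderivative) (auto intro!: continuous_intros simp: continuous_on_eq_continuous_at)
  then obtain H where H: "(H has_vector_derivative exp (a * of_real x) * h x) (at x)" for x
    by auto
  define E where "E = exp (a * of_real (2 * pi))"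
  \<comment> \<open>The constant of integration is chosen so that \<open>g (2 * pi) = g 0\<close>.\<close>
  define C where "C = (H (2 * pi) - E * H 0) / (E - 1)"
  define g where "g = (\<lambda>x. exp (- a * of_real x) * (C + H x))"
  have g': "(g has_vector_derivative h x - a * g x) (at x)" for x
  proof -
    have "(g has_vector_derivative
        - a * exp (- a * of_real x) * (C + H x) + exp (- a * of_real x) * (exp (a * of_real x) * h x)) (at x)"
      unfolding g_def
      by (rule derivative_eq_intros exp_of_real_has_vector_derivative H refl)+ (simp add: algebra_simps)
    then show ?thesis
      by (simp add: g_def algebra_simps exp_minus)
  qed
  have g_periodic: "g (x + 2 * pi) = g x" for x
  proof -
    define g1 where "g1 = (\<lambda>x. g (x + 2 * pi))"
    \<comment> \<open>Since \<open>h\<close> is periodic, the translate \<open>g1\<close> solves the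
      same equation as \<open>g\<close>. Their difference times the integrating factor is therefore
      constant, and the choice of \<open>C\<close> makes it vanish at 0.\<close>
    define v where "v = (\<lambda>x. exp (a * of_real x) * (g1 x - g x))"
    have shift: "(g1 has_vector_derivative h x - a * g1 x) (at x)" for x
    proof -
      have "((g \<circ> (\<lambda>s. s + 2 * pi)) has_vector_derivative
          1 *\<^sub>R (h (x + 2 * pi) - a * g (x + 2 * pi))) (at x)"
        by (rule vector_diff_chain_at) (auto intro!: derivative_eq_intros g')
      then show ?thesis
        using circle_smooth_periodic[OF h, of x] by (simp add: o_def g1_def)
    qed
    have "(v has_vector_derivative 0) (at x)" for x
      unfolding v_def
      by (auto intro!: derivative_eq_intros exp_of_real_has_vector_derivative shift g' simp: algebra_simps)
    then obtain c where "\<And>x. v x = c"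
      using has_vector_derivative_zero_constant[of UNIV v] by auto
    then have "v x = v 0" by simp
    also have "v 0 = 0"
    proof -
      have "E \<noteq> 1" "E \<noteq> 0" using a by (auto simp: E_def)
      then have "inverse E * (C + H (2 * pi)) = C + H 0"
        unfolding C_def by (simp add: field_simps)
      moreover have "exp (- a * of_real (2 * pi)) = inverse E"
        by (simp add: E_def exp_minus)
      moreover have "v 0 = exp (- a * of_real (2 * pi)) * (C + H (2 * pi)) - (C + H 0)"
        by (simp add: v_def g_def g1_def)
      ultimately show ?thesis by simp
    qed
    finally show ?thesis by (simp add: v_def g1_def)
  qed
  \<comment> \<open>The successive derivatives of \<open>g\<close>, found by differentiating
    \<open>g' = h - a g\<close> repeatedly; they feed \<open>smoothI\<close>.\<close>
  define F where "F = rec_nat g (\<lambda>n G x. (D ^^ n) h x - a * G x)"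
  have F0: "F 0 = g" and FSuc: "F (Suc n) = (\<lambda>x. (D ^^ n) h x - a * F n x)" for n
    by (simp_all add: F_def)
  have "(F n has_vector_derivative F (Suc n) x) (at x)" for n x
  proof (induction n)
    case 0
    then show ?case using g'[of x] by (simp add: FSuc F0)
  next
    case (Suc n)
    have "((D ^^ n) h has_vector_derivative (D ^^ Suc n) h x) (at x)"
      using h smooth_has_vector_derivative[OF smooth_funpow_D] by (simp add: circle_smooth_def)
    then show ?case
      using Suc unfolding FSuc[of "Suc n"] by (subst FSuc) (auto intro!: derivative_eq_intros)
  qed
  then have "smooth g" using smoothI[of F] by (simp add: F0)
  then have "circle_smooth g" using g_periodic by (simp add: circle_smooth_def)
  moreover have "D g = (\<lambda>x. h x - a * g x)" by (rule D_eqI) (rule g')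
  ultimately show ?thesis by auto
qed

section \<open>Forms in the coordinate \<open>\<theta>\<close>\<close>

text \<open>The form f + g d\<theta>. \<open>Arg\<close> selects one angle for each point, a choice
  that is immaterial for periodic \<open>f\<close> and \<open>g\<close>; the inner product with
  \<open>unit_tangent p\<close> annihilates the normal line, as the representation of covectors
  demands.\<close>

definition form_of :: "(real \<Rightarrow> complex) \<Rightarrow> (real \<Rightarrow> complex) \<Rightarrow> form"
  where "form_of f g =
    ((\<lambda>p. if p \<in> S1 then f (Arg p) else 0),
     (\<lambda>p v. if p \<in> S1 then of_real (v \<bullet> unit_tangent p) * g (Arg p) else 0))"

lemma cis_in_S1 [simp]: "cis \<theta> \<in> S1"
  by simp

lemma S1_cis: "p \<in> S1 \<Longrightarrow> p = cis (Arg p)"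
  by (cases "p = 0") (auto simp: cis_Arg sgn_div_norm)

lemma circle_smooth_Arg_cis:
  assumes "circle_smooth g"
  shows "g (Arg (cis \<theta>)) = g \<theta>"
proof -
  have "cis (Arg (cis \<theta>)) = cis \<theta>"
    using S1_cis[OF cis_in_S1] by metis
  then obtain k :: int where "Arg (cis \<theta>) = \<theta> + 2 * pi * k"
    unfolding complex_eq_iff using sin_cos_eq_iff by auto
  then show ?thesis
    using periodic_int[of g \<theta> k] assms by (simp add: circle_smooth_periodic)
qed

lemma fst_form_of: "circle_smooth f \<Longrightarrow> fst (form_of f g) (cis \<theta>) = f \<theta>"
  by (simp add: form_of_def circle_smooth_Arg_cis)

lemma snd_form_of:
  "circle_smooth g \<Longrightarrow> snd (form_of f g) (cis \<theta>) v = of_real (v \<bullet> unit_tangent (cis \<theta>)) * g \<theta>"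
  by (simp add: form_of_def circle_smooth_Arg_cis)

lemma unit_tangent_inner_cis [simp]: "unit_tangent (cis \<theta>) \<bullet> unit_tangent (cis \<theta>) = 1"
  by (simp add: unit_tangent_def inner_complex_def flip: power2_eq_square)

lemma snd_form_of_tangent:
  "circle_smooth g \<Longrightarrow> snd (form_of f g) (cis \<theta>) (unit_tangent (cis \<theta>)) = g \<theta>"
  by (simp add: snd_form_of)

lemma circle_smooth_cis:
  assumes "smooth (\<lambda>\<theta>. F (cis \<theta>))"
  shows "circle_smooth (\<lambda>\<theta>. F (cis \<theta>))"
  using assms by (simp add: circle_smooth_def cis.code)

lemma circle_smooth_zero [simp]: "circle_smooth (\<lambda>_. 0)" "D (\<lambda>_. 0) = (\<lambda>_. 0)"
proof -
  show "circle_smooth (\<lambda>_. 0)"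
    using smoothI[of "\<lambda>_ _. 0"] by (simp add: circle_smooth_def)
  show "D (\<lambda>_. 0) = (\<lambda>_. 0)"
    by (simp add: D_def)
qed

lemma smooth_function_form_of:
  assumes "circle_smooth f"
  shows "smooth_function (fst (form_of f g))"
proof -
  have "(\<lambda>\<theta>. fst (form_of f g) (cis \<theta>)) = f"
    using assms by (simp add: fst_form_of)
  then show ?thesis
    using assms by (auto simp: smooth_function_def circle_smooth_def) (simp add: form_of_def)
qed

lemma smooth_one_form_form_of:
  assumes "circle_smooth g"
  shows "smooth_one_form (snd (form_of f g))"
proof -
  have "(\<lambda>\<theta>. snd (form_of f g) (cis \<theta>) (unit_tangent (cis \<theta>))) = g"
    using assms by (simp add: snd_form_of_tangent)
  moreover have "linear (snd (form_of f g) p)" for p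
    by (rule linearI)
      (simp_all add: form_of_def inner_add_left distrib_right, simp add: scaleR_conv_of_real)
  moreover have "snd (form_of f g) p p = 0" for p
    by (simp add: form_of_def unit_tangent_def inner_complex_def)
  moreover have "snd (form_of f g) p v = 0" if "p \<notin> S1" for p v
    using that by (simp add: form_of_def)
  ultimately show ?thesis
    using assms by (simp add: smooth_one_form_def circle_smooth_def)
qed

lemma fst_form_of_component:
  assumes "smooth_function F"
  shows "fst (form_of (\<lambda>\<theta>. F (cis \<theta>)) g) = F"
  using assms S1_cis by (fastforce simp: form_of_def smooth_function_def)

text \<open>At a point \<open>p\<close> of the circle, \<open>p\<close> and
  \<open>unit_tangent p\<close> are an orthonormal basis of the plane. A covector kills
  \<open>p\<close>, so its value on the unit tangent determines it.\<close>

lemma snd_form_of_component: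
  assumes "smooth_one_form \<omega>"
  shows "snd (form_of f (\<lambda>\<theta>. \<omega> (cis \<theta>) (unit_tangent (cis \<theta>)))) = \<omega>"
proof (intro ext)
  fix p v
  show "snd (form_of f (\<lambda>\<theta>. \<omega> (cis \<theta>) (unit_tangent (cis \<theta>)))) p v = \<omega> p v"
  proof (cases "p \<in> S1")
    case True
    then have lin: "linear (\<omega> p)" and normal: "\<omega> p p = 0"
      using assms by (auto simp: smooth_one_form_def)
    have "(Re p)\<^sup>2 + (Im p)\<^sup>2 = 1"
      using True cmod_power2[of p] by simp
    then have "v = (v \<bullet> p) *\<^sub>R p + (v \<bullet> unit_tangent p) *\<^sub>R unit_tangent p"
      unfolding complex_eq_iff unit_tangent_def inner_complex_def by (simp; algebra)
    then have "\<omega> p v = (v \<bullet> p) *\<^sub>R \<omega> p p + (v \<bullet> unit_tangent p) *\<^sub>R \<omega> p (unit_tangent p)"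
      using lin by (metis linear_add linear_scale)
    then show ?thesis
      using True S1_cis[OF True] normal by (simp add: form_of_def scaleR_conv_of_real)
  next
    case False
    then show ?thesis
      using assms by (simp add: form_of_def smooth_one_form_def)
  qed
qed

text \<open>The coordinate functions are recovered by evaluating at \<open>cis \<theta>\<close> and
  on the unit tangent. This reduces every quantification over forms to periodic functions.\<close>

lemma forms_iff:
  "\<alpha> \<in> forms \<longleftrightarrow> (\<exists>f g. circle_smooth f \<and> circle_smooth g \<and> \<alpha> = form_of f g)"
proof
  assume "\<alpha> \<in> forms"
  then have \<alpha>: "smooth_function (fst \<alpha>)" "smooth_one_form (snd \<alpha>)"
    by (auto simp: forms_def)
  let ?f = "\<lambda>\<theta>. fst \<alpha> (cis \<theta>)" and ?g = "\<lambda>\<theta>. snd \<alpha> (cis \<theta>) (unit_tangent (cis \<theta>))"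
  have "circle_smooth ?f"
    using \<alpha> by (intro circle_smooth_cis) (simp add: smooth_function_def)
  moreover have "circle_smooth ?g"
    using \<alpha> circle_smooth_cis[of "\<lambda>p. snd \<alpha> p (unit_tangent p)"] by (simp add: smooth_one_form_def)
  moreover have "\<alpha> = form_of ?f ?g"
    by (intro prod_eqI; use \<alpha> in \<open>simp add: fst_form_of_component snd_form_of_component\<close>)
  ultimately show "\<exists>f g. circle_smooth f \<and> circle_smooth g \<and> \<alpha> = form_of f g"
    by blast
next
  assume "\<exists>f g. circle_smooth f \<and> circle_smooth g \<and> \<alpha> = form_of f g"
  then show "\<alpha> \<in> forms"
    by (auto simp: forms_def mem_Times_iff smooth_function_form_of smooth_one_form_form_of)
qed

lemma one_forms_iff:
  "\<alpha> \<in> one_forms \<longleftrightarrow> (\<exists>g. circle_smooth g \<and> \<alpha> = form_of (\<lambda>_. 0) g)"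
proof
  assume "\<alpha> \<in> one_forms"
  then have \<alpha>: "fst \<alpha> = 0" "smooth_one_form (snd \<alpha>)"
    by (auto simp: one_forms_def)
  let ?g = "\<lambda>\<theta>. snd \<alpha> (cis \<theta>) (unit_tangent (cis \<theta>))"
  have "circle_smooth ?g"
    using \<alpha> circle_smooth_cis[of "\<lambda>p. snd \<alpha> p (unit_tangent p)"] by (simp add: smooth_one_form_def)
  moreover have "\<alpha> = form_of (\<lambda>_. 0) ?g"
    by (intro prod_eqI; use \<alpha> in \<open>simp add: snd_form_of_component\<close>)
      (auto simp: form_of_def fun_eq_iff)
  ultimately show "\<exists>g. circle_smooth g \<and> \<alpha> = form_of (\<lambda>_. 0) g"
    by blast
next
  assume "\<exists>g. circle_smooth g \<and> \<alpha> = form_of (\<lambda>_. 0) g"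
  then show "\<alpha> \<in> one_forms"
    using smooth_one_form_form_of by (auto simp: one_forms_def form_of_def fun_eq_iff)
qed

lemma form_of_eq_iff:
  assumes "circle_smooth f" "circle_smooth g" "circle_smooth f'" "circle_smooth g'"
  shows "form_of f g = form_of f' g' \<longleftrightarrow> f = f' \<and> g = g'"
  using assms by (metis ext fst_form_of snd_form_of_tangent)

lemma form_of_add: "form_of f g + form_of f' g' = form_of (\<lambda>x. f x + f' x) (\<lambda>x. g x + g' x)"
  by (auto simp: form_of_def fun_eq_iff algebra_simps)

lemma form_of_diff: "form_of f g - form_of f' g' = form_of (\<lambda>x. f x - f' x) (\<lambda>x. g x - g' x)"
  by (auto simp: form_of_def fun_eq_iff algebra_simps)

lemma form_scale_form_of: "form_scale c (form_of f g) = form_of (\<lambda>x. c * f x) (\<lambda>x. c * g x)"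
  by (auto simp: form_of_def form_scale_def fun_eq_iff algebra_simps)

lemma form_of_zero [simp]: "form_of (\<lambda>_. 0) (\<lambda>_. 0) = 0"
  by (auto simp: form_of_def fun_eq_iff zero_prod_def)

section \<open>The L2 product and norm in the coordinate\<close>

lemma L2_inner_form_of:
  assumes "circle_smooth f" "circle_smooth g" "circle_smooth f'" "circle_smooth g'"
  shows "L2_inner (form_of f g) (form_of f' g') =
    integral {0..2 * pi} (\<lambda>\<theta>. f \<theta> * cnj (f' \<theta>) + g \<theta> * cnj (g' \<theta>))"
  using assms by (simp add: L2_inner_def Let_def fst_form_of snd_form_of_tangent)

lemma L2_norm_form_of:
  assumes "circle_smooth g"
  shows "L2_norm (form_of (\<lambda>_. 0) g) = nrm g"
proof -
  have "L2_inner (form_of (\<lambda>_. 0) g) (form_of (\<lambda>_. 0) g) =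
      integral {0..2 * pi} (\<lambda>\<theta>. complex_of_real ((norm (g \<theta>))\<^sup>2))"
    using assms by (simp add: L2_inner_form_of del: of_real_power) (simp only: complex_norm_square)
  also have "\<dots> = of_real (integral {0..2 * pi} (\<lambda>\<theta>. (norm (g \<theta>))\<^sup>2))"
    by (intro integral_unique has_integral_of_real integrable_integral
      integrable_continuous_real continuous_intros circle_smooth_continuous[OF assms])
  finally show ?thesis by (simp add: L2_norm_def nrm_def)
qed

lemma nrm_eq_0_iff:
  assumes "circle_smooth g"
  shows "nrm g = 0 \<longleftrightarrow> g = (\<lambda>_. 0)"
proof
  assume "nrm g = 0"
  then have "\<forall>x\<in>{0..2 * pi}. (norm (g x))\<^sup>2 = 0"
    unfolding nrm_def real_sqrt_eq_0_iff
    by (subst (asm) integral_eq_0_iff) (auto intro!: continuous_intros circle_smooth_continuous[OF assms])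
  then have zero: "g x = 0" if "0 \<le> x" "x \<le> 2 * pi" for x
    using that by simp
  have "g x = 0" for x
  proof -
    \<comment> \<open>Continuity gives vanishing on one period; subtracting \<open>k\<close> periods
      moves any \<open>x\<close> into it.\<close>
    define k where "k = \<lfloor>x / (2 * pi)\<rfloor>"
    have "of_int k \<le> x / (2 * pi)" "x / (2 * pi) < of_int k + 1"
      unfolding k_def by linarith+
    then have "g (x - 2 * pi * of_int k) = 0"
      by (intro zero) (auto simp: field_simps)
    then show "g x = 0"
      using periodic_int[of g "x - 2 * pi * of_int k" k] circle_smooth_periodic[OF assms] by simp
  qed
  then show "g = (\<lambda>_. 0)" by auto
qed (simp add: nrm_def)

section \<open>The Laplacian in the coordinate \<open>\<theta>\<close>\<close>

text \<open>Along the geodesic through \<open>p\<close> the angle is the affine function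
  \<open>Arg p + s * c\<close>, so the chain rule gives \<open>c * D f (Arg p)\<close>.\<close>

lemma ext_d_form_of:
  assumes f: "circle_smooth f"
  shows "ext_d (form_of f g) = form_of (\<lambda>_. 0) (D f)"
proof -
  have "vector_derivative (\<lambda>s. fst (form_of f g) (p * cis (s * c))) (at 0) = of_real c * D f (Arg p)"
    if p: "p \<in> S1" for p c
  proof -
    have "((f \<circ> (\<lambda>s. Arg p + s * c)) has_vector_derivative c *\<^sub>R D f (Arg p + 0 * c)) (at 0)"
      by (rule vector_diff_chain_at) (auto intro!: derivative_eq_intros circle_smooth_DERIV[OF f])
    moreover have "(\<lambda>s. fst (form_of f g) (p * cis (s * c))) = f \<circ> (\<lambda>s. Arg p + s * c)"
      by (subst S1_cis[OF p]) (simp add: cis_mult fst_form_of[OF f] o_def)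
    ultimately show ?thesis
      by (simp add: vector_derivative_at scaleR_conv_of_real)
  qed
  then show ?thesis
    by (simp add: ext_d_def form_of_def[of "\<lambda>_. 0"] fun_eq_iff zero_prod_def)
qed

text \<open>The boundary terms cancel by periodicity, which makes \<open>- D\<close> the formal
  adjoint of \<open>D\<close>.\<close>

lemma integral_by_parts:
  assumes f: "circle_smooth f" and g: "circle_smooth g"
  shows "integral {0..2 * pi} (\<lambda>\<theta>. D f \<theta> * cnj (g \<theta>)) = integral {0..2 * pi} (\<lambda>\<theta>. f \<theta> * cnj (- D g \<theta>))"
proof -
  have "((\<lambda>\<theta>. D f \<theta> * cnj (g \<theta>) - f \<theta> * cnj (- D g \<theta>)) has_integral
      (f (2 * pi) * cnj (g (2 * pi)) - f 0 * cnj (g 0))) {0..2 * pi}"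
  proof (rule fundamental_theorem_of_calculus)
    fix x
    have "((\<lambda>\<theta>. cnj (g \<theta>)) has_vector_derivative cnj (D g x)) (at x)"
      using circle_smooth_DERIV[OF g] by (rule bounded_linear.has_vector_derivative[OF bounded_linear_cnj])
    with circle_smooth_DERIV[OF f]
    have "((\<lambda>\<theta>. f \<theta> * cnj (g \<theta>)) has_vector_derivative f x * cnj (D g x) + D f x * cnj (g x)) (at x)"
      by (rule has_vector_derivative_mult)
    then show "((\<lambda>\<theta>. f \<theta> * cnj (g \<theta>)) has_vector_derivative
        D f x * cnj (g x) - f x * cnj (- D g x)) (at x within {0..2 * pi})"
      by (simp add: has_vector_derivative_at_within add.commute)
  qed simp
  moreover have "f (2 * pi) = f 0" "g (2 * pi) = g 0"
    using circle_smooth_periodic[OF f, of 0] circle_smooth_periodic[OF g, of 0] by simp_all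
  ultimately have diff: "integral {0..2 * pi} (\<lambda>\<theta>. D f \<theta> * cnj (g \<theta>) - f \<theta> * cnj (- D g \<theta>)) = 0"
    by (simp only: integral_unique diff_self)
  have int: "(\<lambda>\<theta>. D f \<theta> * cnj (g \<theta>)) integrable_on {0..2 * pi}"
    "(\<lambda>\<theta>. f \<theta> * cnj (- D g \<theta>)) integrable_on {0..2 * pi}"
    by (intro integrable_continuous_real continuous_intros circle_smooth_continuous circle_smooth_D f g)+
  show ?thesis
    using diff unfolding integral_diff[OF int] by (simp only: right_minus_eq)
qed

lemma circle_smooth_add: "circle_smooth f \<Longrightarrow> circle_smooth g \<Longrightarrow> circle_smooth (\<lambda>x. f x + g x)"
  using circle_smooth_lin(1)[of f g 1 1] by simp

lemma circle_smooth_diff: "circle_smooth f \<Longrightarrow> circle_smooth g \<Longrightarrow> circle_smooth (\<lambda>x. f x - g x)"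
  using circle_smooth_lin(1)[of f g 1 "- 1"] by simp

lemma circle_smooth_scale: "circle_smooth f \<Longrightarrow> circle_smooth (\<lambda>x. c * f x)"
  using circle_smooth_lin(1)[of f "\<lambda>_. 0" c 0] by simp

lemma circle_smooth_uminus: "circle_smooth f \<Longrightarrow> circle_smooth (\<lambda>x. - f x)"
  using circle_smooth_scale[of f "- 1"] by simp

lemmas circle_smooth_intros = circle_smooth_zero(1) circle_smooth_add circle_smooth_diff
  circle_smooth_scale circle_smooth_uminus circle_smooth_D

text \<open>Integration by parts shows that the right-hand side meets the description of the
  adjoint; definiteness of the L2 product on smooth forms shows that nothing else does.\<close>

lemma codiff_form_of:
  assumes f: "circle_smooth f" and g: "circle_smooth g"
  shows "codiff (form_of f g) = form_of (\<lambda>x. - D g x) (\<lambda>_. 0)"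
  unfolding codiff_def
proof (rule the_equality)
  have adjoint: "L2_inner (ext_d \<gamma>) (form_of f g) = L2_inner \<gamma> (form_of (\<lambda>x. - D g x) (\<lambda>_. 0))"
    if \<gamma>: "\<gamma> \<in> forms" for \<gamma>
  proof -
    obtain u w where u: "circle_smooth u" and w: "circle_smooth w" and "\<gamma> = form_of u w"
      using \<gamma> forms_iff by blast
    then show ?thesis
      using integral_by_parts[OF u g]
      by (simp add: ext_d_form_of L2_inner_form_of f g circle_smooth_intros)
  qed
  moreover have "circle_smooth (\<lambda>x. - D g x)"
    by (intro circle_smooth_intros g)
  then have "form_of (\<lambda>x. - D g x) (\<lambda>_. 0) \<in> forms"
    unfolding forms_iff using circle_smooth_zero(1) by blast
  ultimately show "form_of (\<lambda>x. - D g x) (\<lambda>_. 0) \<in> forms \<and>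
      (\<forall>\<gamma>\<in>forms. L2_inner (ext_d \<gamma>) (form_of f g) = L2_inner \<gamma> (form_of (\<lambda>x. - D g x) (\<lambda>_. 0)))"
    by blast
  fix \<beta>
  assume \<beta>: "\<beta> \<in> forms \<and> (\<forall>\<gamma>\<in>forms. L2_inner (ext_d \<gamma>) (form_of f g) = L2_inner \<gamma> \<beta>)"
  then obtain u w where u: "circle_smooth u" and w: "circle_smooth w" and \<beta>_eq: "\<beta> = form_of u w"
    using forms_iff by blast
  \<comment> \<open>The test components \<open>r\<close> and \<open>v\<close> are independent, so
    setting one to zero isolates \<open>w\<close> or \<open>u\<close>.\<close>
  have eq: "integral {0..2 * pi} (\<lambda>x. r x * cnj (u x) + v x * cnj (w x)) =
      integral {0..2 * pi} (\<lambda>x. r x * cnj (- D g x))"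
    if r: "circle_smooth r" and v: "circle_smooth v" for r v
  proof -
    have "form_of r v \<in> forms"
      using r v forms_iff by blast
    then have "L2_inner (form_of r v) (form_of u w) = L2_inner (form_of r v) (form_of (\<lambda>x. - D g x) (\<lambda>_. 0))"
      using \<beta> adjoint \<beta>_eq by metis
    then show ?thesis
      using r v u w g by (simp add: L2_inner_form_of circle_smooth_intros)
  qed
  have zero: "v = (\<lambda>_. 0)"
    if v: "circle_smooth v" and "integral {0..2 * pi} (\<lambda>x. v x * cnj (v x)) = 0" for v
  proof -
    have "L2_norm (form_of (\<lambda>_. 0) v) = 0"
      using that by (simp add: L2_norm_def L2_inner_form_of)
    then show ?thesis
      using v by (simp add: L2_norm_form_of nrm_eq_0_iff)
  qed
  have diff_zero: "a = b"
    if a: "circle_smooth a" and b: "circle_smooth b"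
      and "\<And>v. circle_smooth v \<Longrightarrow>
        integral {0..2 * pi} (\<lambda>x. v x * cnj (a x)) = integral {0..2 * pi} (\<lambda>x. v x * cnj (b x))" for a b
  proof -
    \<comment> \<open>Testing against the difference itself turns the equality of pairings into a
      vanishing norm.\<close>
    let ?v = "\<lambda>x. a x - b x"
    have v: "circle_smooth ?v" by (intro circle_smooth_intros a b)
    have "integral {0..2 * pi} (\<lambda>x. ?v x * cnj (?v x)) =
        integral {0..2 * pi} (\<lambda>x. ?v x * cnj (a x)) - integral {0..2 * pi} (\<lambda>x. ?v x * cnj (b x))"
      unfolding complex_cnj_diff right_diff_distrib
      by (intro integral_diff integrable_continuous_real continuous_intros circle_smooth_continuous a b v)
    also have "\<dots> = 0" using that(3)[OF v] by simp
    finally have "?v = (\<lambda>_. 0)" by (intro zero v)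
    then show "a = b" by (simp add: fun_eq_iff)
  qed
  have "w = (\<lambda>_. 0)"
    using eq[OF circle_smooth_zero(1)] w by (intro diff_zero) auto
  moreover have "u = (\<lambda>x. - D g x)"
    using eq[OF _ circle_smooth_zero(1)] u g by (intro diff_zero circle_smooth_intros) auto
  ultimately show "\<beta> = form_of (\<lambda>x. - D g x) (\<lambda>_. 0)"
    using \<beta>_eq by simp
qed

lemma sharp_scaled_dtheta:
  assumes "p \<in> S1"
  shows "sharp (scaled t dtheta) p = t *\<^sub>R unit_tangent p"
  unfolding sharp_def
proof (rule the_equality)
  show "t *\<^sub>R unit_tangent p \<in> tangent_space p \<and>
      (\<forall>v\<in>tangent_space p. scaled t dtheta p v = (t *\<^sub>R unit_tangent p) \<bullet> v)"
    using assms by (auto simp: tangent_space_def scaled_def dtheta_def unit_tangent_def inner_complex_def)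
      (auto simp: algebra_simps)
  fix u
  assume "u \<in> tangent_space p \<and> (\<forall>v\<in>tangent_space p. scaled t dtheta p v = u \<bullet> v)"
  \<comment> \<open>The difference of two candidates is tangent and orthogonal to every tangent
    vector, hence to itself.\<close>
  then have u: "u - t *\<^sub>R unit_tangent p \<in> tangent_space p"
    and "\<And>v. v \<in> tangent_space p \<Longrightarrow> (u - t *\<^sub>R unit_tangent p) \<bullet> v = 0"
    using assms by (auto simp: tangent_space_def scaled_def dtheta_def unit_tangent_def inner_complex_def)
      (auto simp: algebra_simps)
  then show "u = t *\<^sub>R unit_tangent p"
    by (metis eq_iff_diff_eq_0 inner_eq_zero_iff)
qed

lemma contract_form_of:
  assumes "circle_smooth g"
  shows "contract (scaled t dtheta) (form_of f g) = form_of (\<lambda>x. of_real t * g x) (\<lambda>_. 0)"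
proof -
  have "snd (form_of f g) p (sharp (scaled t dtheta) p) = (if p \<in> S1 then of_real t * g (Arg p) else 0)" for p
  proof (cases "p \<in> S1")
    case True
    then have "unit_tangent p \<bullet> unit_tangent p = 1"
      using S1_cis unit_tangent_inner_cis by metis
    then show ?thesis
      using True by (simp add: sharp_scaled_dtheta form_of_def)
  qed (simp add: form_of_def)
  then show ?thesis
    by (simp add: contract_def form_of_def[of _ "\<lambda>_. 0"] fun_eq_iff)
qed

lemma wedge_form_of:
  "wedge (scaled t dtheta) (form_of f g) = form_of (\<lambda>_. 0) (\<lambda>x. of_real t * f x)"
  by (auto simp: wedge_def form_of_def scaled_def dtheta_def fun_eq_iff)

text \<open>The magnetic differential kills 1-forms, so only \<open>magnetic_d\<close> after
  \<open>magnetic_codiff\<close> survives. In coordinates this is -(D + it)(D + it), written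
  out.\<close>

lemma magnetic_laplacian_form_of:
  assumes g: "circle_smooth g"
  shows "magnetic_laplacian (scaled t dtheta) (form_of (\<lambda>_. 0) g) =
    form_of (\<lambda>_. 0) (\<lambda>x. - (D (D g) x + 2 * (\<i> * t) * D g x + (\<i> * t)\<^sup>2 * g x))"
proof -
  have 1: "magnetic_d (scaled t dtheta) (form_of (\<lambda>_. 0) g) = form_of (\<lambda>_. 0) (\<lambda>_. 0)"
    by (simp add: magnetic_d_def ext_d_form_of wedge_form_of form_scale_form_of form_of_add
        del: form_of_zero)
  have 2: "magnetic_codiff (scaled t dtheta) (form_of (\<lambda>_. 0) (\<lambda>_. 0)) = 0"
    by (simp add: magnetic_codiff_def codiff_form_of contract_form_of form_scale_form_of form_of_diff
        del: form_of_zero)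
  \<comment> \<open>The coefficients \<open>- 1\<close> and \<open>- \<i> * t\<close> are kept
    explicit to match \<open>circle_smooth_lin\<close>.\<close>
  have 3: "magnetic_codiff (scaled t dtheta) (form_of (\<lambda>_. 0) g) =
      form_of (\<lambda>x. (- 1) * D g x + (- \<i> * t) * g x) (\<lambda>_. 0)"
    by (simp add: magnetic_codiff_def codiff_form_of contract_form_of form_scale_form_of form_of_diff g
        algebra_simps)
  have 4: "magnetic_d (scaled t dtheta) (form_of f (\<lambda>_. 0)) = form_of (\<lambda>_. 0) (\<lambda>x. D f x + \<i> * t * f x)"
    if "circle_smooth f" for f
    using that by (simp add: magnetic_d_def ext_d_form_of wedge_form_of form_scale_form_of form_of_add
        algebra_simps)
  show ?thesis
    unfolding magnetic_laplacian_def 1 2 3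
      4[OF circle_smooth_lin(1)[OF circle_smooth_D[OF g] g]]
      circle_smooth_lin(2)[OF circle_smooth_D[OF g] g]
    by (simp add: algebra_simps power2_eq_square)
qed

section \<open>Spectrum and kernel\<close>

text \<open>Writing the spectral parameter as a square lets the second-order operator factor as -(D
  + i(t - w))(D + i(t + w)).\<close>

lemma laplacian_minus_scale_form_of:
  assumes g: "circle_smooth g"
  shows "magnetic_laplacian (scaled t dtheta) (form_of (\<lambda>_. 0) g) - form_scale (w\<^sup>2) (form_of (\<lambda>_. 0) g) =
    form_of (\<lambda>_. 0) (\<lambda>x. - (D (\<lambda>x. D g x + \<i> * (t + w) * g x) x
      + \<i> * (t - w) * (D g x + \<i> * (t + w) * g x)))"
proof -
  have "D (\<lambda>x. D g x + \<i> * (t + w) * g x) = (\<lambda>x. D (D g) x + \<i> * (t + w) * D g x)"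
    using circle_smooth_lin(2)[OF circle_smooth_D[OF g] g, of 1 "\<i> * (t + w)"] by simp
  then show ?thesis
    by (simp add: magnetic_laplacian_form_of g form_scale_form_of form_of_diff)
      (simp add: algebra_simps power2_eq_square)
qed

text \<open>Each first-order factor is bounded below and solvable. The lower bounds multiply, and
  solving the two equations in turn reaches every smooth 1-form exactly, so the range is
  dense.\<close>

lemma regular_value_magnetic_laplacian:
  assumes "exp (\<i> * (t - w) * of_real (2 * pi)) \<noteq> 1" "exp (\<i> * (t + w) * of_real (2 * pi)) \<noteq> 1"
  shows "regular_value one_forms (magnetic_laplacian (scaled t dtheta)) (w\<^sup>2)"
proof -
  define a b where "a = \<i> * (t - w)" and "b = \<i> * (t + w)"
  have ab: "exp (a * of_real (2 * pi)) \<noteq> 1" "exp (b * of_real (2 * pi)) \<noteq> 1"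
    using assms by (simp_all add: a_def b_def)
  define L where "L c g = (\<lambda>x. D g x + c * g x)" for c and g :: "real \<Rightarrow> complex"
  have L: "circle_smooth (L c g)" if "circle_smooth g" for c g
    unfolding L_def using that by (intro circle_smooth_intros)
  have T: "magnetic_laplacian (scaled t dtheta) (form_of (\<lambda>_. 0) g) - form_scale (w\<^sup>2) (form_of (\<lambda>_. 0) g)
      = form_of (\<lambda>_. 0) (\<lambda>x. - L a (L b g) x)" if "circle_smooth g" for g
    using that by (simp add: laplacian_minus_scale_form_of L_def a_def b_def)
  obtain c where c: "c > 0" "\<And>g. circle_smooth g \<Longrightarrow> c * nrm g \<le> nrm (L a g)"
    using first_order_bound[OF ab(1)] unfolding L_def by blast
  obtain d where d: "d > 0" "\<And>g. circle_smooth g \<Longrightarrow> d * nrm g \<le> nrm (L b g)"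
    using first_order_bound[OF ab(2)] unfolding L_def by blast
  show ?thesis
    unfolding regular_value_def
  proof (intro conjI exI ballI allI impI)
    show "c * d > 0" using c d by simp
    fix \<alpha> assume "\<alpha> \<in> one_forms"
    then obtain g where g: "circle_smooth g" "\<alpha> = form_of (\<lambda>_. 0) g"
      using one_forms_iff by blast
    have "c * d * nrm g \<le> c * nrm (L b g)"
      using c d(2)[OF g(1)] by simp
    also have "\<dots> \<le> nrm (L a (L b g))"
      by (intro c L g)
    also have "\<dots> = nrm (\<lambda>x. - L a (L b g) x)"
      by (simp add: nrm_def)
    finally show "c * d * L2_norm \<alpha> \<le>
        L2_norm (magnetic_laplacian (scaled t dtheta) \<alpha> - form_scale (w\<^sup>2) \<alpha>)"
      using g by (simp add: T L2_norm_form_of L circle_smooth_intros)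
  next
    fix \<beta> and \<epsilon> :: real assume "\<beta> \<in> one_forms" "\<epsilon> > 0"
    then obtain h where h: "circle_smooth h" "\<beta> = form_of (\<lambda>_. 0) h"
      using one_forms_iff by blast
    \<comment> \<open>The outer factor is inverted first; the overall minus sign of the
      factorisation is moved onto \<open>h\<close>.\<close>
    obtain k where k: "circle_smooth k" "\<And>x. L a k x = - h x"
      using first_order_solution[OF ab(1) circle_smooth_uminus[OF h(1)]] unfolding L_def by blast
    obtain g where g: "circle_smooth g" "\<And>x. L b g x = k x"
      using first_order_solution[OF ab(2) k(1)] unfolding L_def by blast
    have "L b g = k" using g by auto
    then have "magnetic_laplacian (scaled t dtheta) (form_of (\<lambda>_. 0) g)
        - form_scale (w\<^sup>2) (form_of (\<lambda>_. 0) g) - \<beta> = 0"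
      using k h by (simp add: T g form_of_diff)
    moreover have "L2_norm 0 = 0"
      by (simp add: L2_norm_def L2_inner_def)
    moreover have "form_of (\<lambda>_. 0) g \<in> one_forms"
      using g one_forms_iff by blast
    ultimately show "\<exists>\<alpha>\<in>one_forms.
        L2_norm (magnetic_laplacian (scaled t dtheta) \<alpha> - form_scale (w\<^sup>2) \<alpha> - \<beta>) < \<epsilon>"
      using \<open>\<epsilon> > 0\<close> by metis
  qed
qed

lemma exp_int_circle: "exp (\<i> * of_int k * of_real (2 * pi)) = (1 :: complex)"
  using exp_eq_1[of "\<i> * of_int k * of_real (2 * pi)"] by auto

text \<open>The 1-form with coefficient exp(ik\<theta>) is a nonzero eigenform, which contradicts
  any positive lower bound.\<close>

lemma eigenvalue_in_spectrum:
  fixes k :: int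
  shows "complex_of_real ((of_int k + t)\<^sup>2) \<in> spectrum one_forms (magnetic_laplacian (scaled t dtheta))"
proof -
  define e where "e = (\<lambda>x. exp (\<i> * of_int k * complex_of_real x))"
  \<comment> \<open>The sign makes \<open>t + w = - k\<close>, so the inner factor D - ik already
    annihilates \<open>e\<close>.\<close>
  define w where "w = - complex_of_real (of_int k + t)"
  have e: "circle_smooth e" "D e = (\<lambda>x. \<i> * of_int k * e x)"
    unfolding e_def by (rule circle_smooth_exp exp_int_circle)+
  have "magnetic_laplacian (scaled t dtheta) (form_of (\<lambda>_. 0) e) - form_scale (w\<^sup>2) (form_of (\<lambda>_. 0) e) = 0"
    by (simp add: laplacian_minus_scale_form_of e(1)) (simp add: e(2) w_def)
  moreover have "L2_norm 0 = 0"
    by (simp add: L2_norm_def L2_inner_def)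
  moreover have "L2_norm (form_of (\<lambda>_. 0) e) > 0"
  proof -
    have "e \<noteq> (\<lambda>_. 0)" by (auto simp: e_def fun_eq_iff)
    moreover have "nrm e \<ge> 0"
      unfolding nrm_def by (auto intro!: integral_nonneg integrable_continuous_real continuous_intros
          circle_smooth_continuous e)
    ultimately show ?thesis
      using nrm_eq_0_iff[OF e(1)] by (simp add: L2_norm_form_of e)
  qed
  moreover have "form_of (\<lambda>_. 0) e \<in> one_forms"
    using e one_forms_iff by blast
  ultimately have "\<not> regular_value one_forms (magnetic_laplacian (scaled t dtheta)) (w\<^sup>2)"
    unfolding regular_value_def by (metis mult_pos_pos not_less)
  moreover have "w\<^sup>2 = complex_of_real ((of_int k + t)\<^sup>2)"
    by (simp only: w_def power2_minus of_real_power)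
  ultimately show ?thesis
    unfolding spectrum_def by simp
qed

lemma spectrum_magnetic_laplacian:
  "spectrum one_forms (magnetic_laplacian (scaled t dtheta)) =
    {complex_of_real ((of_int k + t)\<^sup>2) |k::int. True}"
proof (intro subset_antisym subsetI)
  fix z assume z: "z \<in> spectrum one_forms (magnetic_laplacian (scaled t dtheta))"
  \<comment> \<open>Every complex \<open>z\<close> is a square, so nonreal \<open>z\<close> are
    covered by the same factorisation.\<close>
  define w where "w = csqrt z"
  have z_eq: "z = w\<^sup>2" by (simp add: w_def)
  \<comment> \<open>The real part of the exponent forces \<open>u\<close> to be real; the imaginary
    part forces it to be an integer.\<close>
  have int: "\<exists>n::int. u = of_int n" if "exp (\<i> * u * of_real (2 * pi)) = 1" for u
    using that unfolding exp_eq_1 by (auto simp: complex_eq_iff)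
  have "exp (\<i> * (t - w) * of_real (2 * pi)) = 1 \<or> exp (\<i> * (t + w) * of_real (2 * pi)) = 1"
    using z regular_value_magnetic_laplacian[of t w] unfolding spectrum_def z_eq by blast
  then obtain n :: int where "t - w = of_int n \<or> t + w = of_int n"
    using int by blast
  \<comment> \<open>Both alternatives give \<open>w\<close> up to sign, and squaring removes the
    sign.\<close>
  then have "w = - complex_of_real (of_int (- n) + t) \<or> w = complex_of_real (of_int (- n) + t)"
    by (auto simp: algebra_simps)
  then have "z = complex_of_real ((of_int (- n) + t)\<^sup>2)"
    unfolding z_eq by (elim disjE) (simp_all only: power2_minus of_real_power)
  then show "z \<in> {complex_of_real ((of_int k + t)\<^sup>2) |k::int. True}"
    by blast
qed (use eigenvalue_in_spectrum in auto)

section \<open>The kernel for an integer potential\<close>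

lemma periodic_constant_derivative:
  fixes u :: "real \<Rightarrow> complex"
  assumes u: "u (2 * pi) = u 0" and u': "\<And>x. (u has_vector_derivative c) (at x)"
  shows "u x = u 0"
proof -
  have "((\<lambda>x. u x - of_real x * c) has_vector_derivative 0) (at x)" for x
    using u'[of x] by (auto intro!: derivative_eq_intros)
  then obtain b where affine: "\<And>x. u x - of_real x * c = b"
    using has_vector_derivative_zero_constant[of UNIV "\<lambda>x. u x - of_real x * c"] by auto
  \<comment> \<open>An affine function with equal values at 0 and \<open>2 * pi\<close> has slope
    zero.\<close>
  have "c = 0"
    using affine[of "2 * pi"] affine[of 0] u by simp
  then show ?thesis using affine[of x] affine[of 0] by simp
qed

text \<open>Multiplication by exp(ik\<theta>) conjugates D + ik into D. As \<open>k\<close> is an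
  integer this factor is periodic, so a kernel element becomes a periodic function with constant
  derivative, hence a constant.\<close>

lemma kernel_magnetic_laplacian:
  "{\<alpha> \<in> one_forms. magnetic_laplacian (scaled (of_int k) dtheta) \<alpha> = 0} =
    form.span {form_of (\<lambda>_. 0) (\<lambda>x. exp (\<i> * of_int (- k) * of_real x))}"
proof -
  define e where "e = (\<lambda>j x. exp (\<i> * of_int j * complex_of_real x))"
  have e: "circle_smooth (e j)" "D (e j) = (\<lambda>x. \<i> * of_int j * e j x)" for j
    unfolding e_def by (rule circle_smooth_exp exp_int_circle)+
  have inverse: "e (- k) x * e k x = 1" for x
    by (simp add: e_def exp_minus)
  have kernel: "magnetic_laplacian (scaled (of_int k) dtheta) (form_of (\<lambda>_. 0) g) = 0 \<longleftrightarrow>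
      (\<exists>c. g = (\<lambda>x. c * e (- k) x))" if g: "circle_smooth g" for g
  proof -
    define q where "q = (\<lambda>x. - (D (D g) x + 2 * (\<i> * of_int k) * D g x + (\<i> * of_int k)\<^sup>2 * g x))"
    have q: "circle_smooth q" unfolding q_def by (intro circle_smooth_intros g)
    have lap: "magnetic_laplacian (scaled (of_int k) dtheta) (form_of (\<lambda>_. 0) g) = form_of (\<lambda>_. 0) q"
      using magnetic_laplacian_form_of[OF g, of "of_int k"] by (simp add: q_def)
    have q_iff: "form_of (\<lambda>_. 0) q = 0 \<longleftrightarrow> q = (\<lambda>_. 0)"
      using form_of_eq_iff[of "\<lambda>_. 0" q "\<lambda>_. 0" "\<lambda>_. 0"] q by simp
    show ?thesis
      unfolding lap q_iff
    proof
      assume q0: "q = (\<lambda>_. 0)"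
      \<comment> \<open>With \<open>f\<close> = (D + ik)g the equation \<open>q = 0\<close> reads (D
        + ik)f = 0, so two first-order steps suffice.\<close>
      define f where "f = (\<lambda>x. D g x + \<i> * of_int k * g x)"
      define u where "u = (\<lambda>x. e k x * g x)"
      have f: "circle_smooth f" unfolding f_def by (intro circle_smooth_intros g)
      have "D f = (\<lambda>x. D (D g) x + \<i> * of_int k * D g x)"
        unfolding f_def using circle_smooth_lin(2)[OF circle_smooth_D[OF g] g, of 1 "\<i> * of_int k"] by simp
      then have "D f x + \<i> * of_int k * f x = - q x" for x
        by (simp add: f_def q_def power2_eq_square algebra_simps)
      then have Df: "D f x + \<i> * of_int k * f x = 0" for x
        using q0 by simp
      have prod_DERIV: "((\<lambda>x. e k x * f x) has_vector_derivative e k x * (D f x + \<i> * of_int k * f x)) (at x)"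
        if "circle_smooth f" for f x
        using circle_smooth_DERIV[OF e(1), of k x] circle_smooth_DERIV[OF that, of x]
        by (auto intro!: derivative_eq_intros simp: e(2) algebra_simps)
      have "((\<lambda>x. e k x * f x) has_vector_derivative 0) (at x)" for x
        using prod_DERIV[OF f, of x] Df[of x] by simp
      then obtain c where "\<And>x. e k x * f x = c"
        using has_vector_derivative_zero_constant[of UNIV "\<lambda>x. e k x * f x"] by auto
      \<comment> \<open>By the product rule the derivative of \<open>u\<close> is
        \<open>e k x * f x\<close>, just shown to be constant.\<close>
      then have "(u has_vector_derivative c) (at x)" for x
        using prod_DERIV[OF g, of x] by (simp add: u_def f_def)
      moreover have "u (2 * pi) = u 0"
        using circle_smooth_periodic[OF g, of 0] circle_smooth_periodic[OF e(1), of k 0] by (simp add: u_def)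
      ultimately have u: "u x = u 0" for x
        by (rule periodic_constant_derivative[rotated])
      have "g x = u 0 * e (- k) x" for x
      proof -
        have "g x = e (- k) x * e k x * g x" by (simp add: inverse)
        also have "\<dots> = u x * e (- k) x" by (simp add: u_def)
        finally show ?thesis using u by simp
      qed
      then show "\<exists>c. g = (\<lambda>x. c * e (- k) x)" by blast
    next
      assume "\<exists>c. g = (\<lambda>x. c * e (- k) x)"
      then obtain c where c: "g = (\<lambda>x. c * e (- k) x)" ..
      \<comment> \<open>\<open>D\<close> acts on multiples of \<open>e (- k)\<close> as the scalar
        -ik, so D + ik annihilates them; \<open>b\<close> is free so that the rule can be applied
        twice.\<close>
      have D_scale: "D (\<lambda>x. b * e (- k) x) = (\<lambda>x. - (\<i> * of_int k) * b * e (- k) x)" for b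
        using circle_smooth_lin(2)[OF e(1) circle_smooth_zero(1), of b "- k" 0]
        by (simp add: e(2) mult_ac)
      show "q = (\<lambda>_. 0)"
        unfolding q_def c D_scale by (simp add: power2_eq_square algebra_simps)
    qed
  qed
  have span: "form.span {form_of (\<lambda>_. 0) (e (- k))} = range (\<lambda>c. form_of (\<lambda>_. 0) (\<lambda>x. c * e (- k) x))"
    by (simp add: form.span_singleton form_scale_form_of)
  have "\<alpha> \<in> one_forms \<and> magnetic_laplacian (scaled (of_int k) dtheta) \<alpha> = 0 \<longleftrightarrow>
      (\<exists>c. \<alpha> = form_of (\<lambda>_. 0) (\<lambda>x. c * e (- k) x))" for \<alpha>
    using kernel circle_smooth_scale[OF e(1)] unfolding one_forms_iff by blast
  then have "{\<alpha> \<in> one_forms. magnetic_laplacian (scaled (of_int k) dtheta) \<alpha> = 0} =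
      form.span {form_of (\<lambda>_. 0) (e (- k))}"
    unfolding span by blast
  then show ?thesis by (simp only: e_def)
qed

lemma magnetic_betti_1_int: "magnetic_betti_1 (scaled (of_int k) dtheta) = 1"
proof -
  define \<omega> where "\<omega> = form_of (\<lambda>_. 0) (\<lambda>x. exp (\<i> * of_int (- k) * of_real x))"
  have "snd \<omega> (cis 0) (unit_tangent (cis 0)) \<noteq> 0"
    unfolding \<omega>_def snd_form_of_tangent[OF circle_smooth_exp(1)[OF exp_int_circle]] by simp
  then have "\<omega> \<noteq> 0" by auto
  then have "form.dim (form.span {\<omega>}) = card {\<omega>}"
    by (intro form.dim_span_eq_card_independent) simp
  then show ?thesis
    unfolding magnetic_betti_1_def kernel_magnetic_laplacian \<omega>_def by simp
qed

theorem theorem4p1: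
  "(\<forall>t::real. t > 0 \<longrightarrow>
      spectrum one_forms (magnetic_laplacian (scaled t dtheta)) =
        {complex_of_real ((of_int k + t)\<^sup>2) |k::int. True} \<union>
        {complex_of_real ((of_int k - t)\<^sup>2) |k::int. True}) \<and>
   (\<forall>k::int. magnetic_betti_1 (scaled (of_int k) dtheta) = 1)"
proof (intro conjI allI impI)
  fix t :: real
  \<comment> \<open>Replacing \<open>k\<close> by \<open>- k\<close> carries one family onto the
    other, so their union is the single family already found.\<close>
  have "complex_of_real ((of_int k - t)\<^sup>2) = complex_of_real ((of_int (- k) + t)\<^sup>2)" for k :: int
    by (simp add: power2_eq_square algebra_simps)
  then show "spectrum one_forms (magnetic_laplacian (scaled t dtheta)) =
      {complex_of_real ((of_int k + t)\<^sup>2) |k::int. True} \<union>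
      {complex_of_real ((of_int k - t)\<^sup>2) |k::int. True}"
    unfolding spectrum_magnetic_laplacian by blast
qed (rule magnetic_betti_1_int)

end
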